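(* Let $a,b$ be coprime positive integers with $b>1$, and let $Q$ be a $0$-stable path in $\mathcal{P}$. (a) $Q$ is $(b-1)$-skeletal if and only if $Q$ is an $(a,b)$-Dyck path. (b) $Q$ is $0$-skeletal if and only if $\widehat{Q}$ is an inverted $(a,b)$-Dyck path. (c) The map sending an $(a,b)$-Dyck path $Q$ to the path $Q^*$ that starts at $(-e,0)$ and whose step sequence is the reverse of the step sequence of $Q$ is a bijection from $(a,b)$-Dyck paths to inverted $(a,b)$-Dyck paths. (d) The analogues of (a), (b) and (c) hold for labeled paths, where $\widehat{Q}$ carries the labels of $Q$ along with their north steps, and for (c) the labeled path $Q^*$ is obtained by reversing the sequence of steps of $Q$ (labels moving with their north steps) and then re-sorting the labels within each maximal run of north steps to increase from bottom to top.
   Context: Let $\mathcal{P}$ be the set of lattice paths from $(0,0)$ to $(a,b)$ with $b$ unit north steps and $a$ unit east steps. The level of a lattice point $(x,y)$ is $ay-bx$. A path is an $(a,b)$-Dyck path if all its north steps start at points of level $\ge0$. For $Q\in\mathcal{P}$ and a lattice point $v$ on $Q$, $Q_v$ is the path from the origin whose steps are those of $Q$ from $v$ to $(a,b)$ followed by those of $Q$ from $(0,0)$ to $v$. For $0\le k<b$, $Q$ is $k$-stable if its last $k+1$ north steps start at points of level $\ge0$; $Q$ is $k$-skeletal if $Q$ is $k$-stable and, for every lattice point $v$ on $Q$ of level $>0$, $Q_v$ is not $k$-stable. A labeled path is a path in $\mathcal{P}$ with labels $1,\dots,b$ assigned bijectively to its north steps, increasing bottom to top within each maximal run of consecutive north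 steps; it is $k$-stable/$k$-skeletal/Dyck if its underlying path is. Let $e=1+\lfloor a/b\rfloor$. Any $0$-stable $Q$ ends with at least $e$ east steps; $\widehat{Q}$ denotes the path from $(-e,0)$ to $(a-e,b)$ obtained from $Q$ by moving its last $e$ east steps to the beginning. Let $\Delta'$ be the closed triangle with vertices $(-e,0)$, $(a-e,0)$, $(a-e,b)$. An inverted $(a,b)$-Dyck path (labeled or not) is a lattice path from $(-e,0)$ to $(a-e,b)$ with unit north and east steps that stays within $\Delta'$. *)

theory Defs
  imports "HOL-Analysis.Analysis"
begin

text \<open>North steps carry a label of type \<open>'l\<close>; unlabeled paths are those with \<open>'l = unit\<close>.\<close>

datatype 'l step = is_East: East | is_North: North (label: 'l)

datatype 'l lattice_path = Path (start: "int \<times> int") (steps: "'l step list")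

definition underlying :: "'l lattice_path \<Rightarrow> unit lattice_path" where
  "underlying = map_lattice_path (\<lambda>_. ())"

text \<open>The lattice point reached after the first \<open>i\<close> steps.\<close>

definition vertex :: "'l lattice_path \<Rightarrow> nat \<Rightarrow> int \<times> int" where
  "vertex Q i =
     (fst (start Q) + int (length (filter is_East (take i (steps Q)))),
      snd (start Q) + int (length (filter is_North (take i (steps Q)))))"

definition lattice_points :: "'l lattice_path \<Rightarrow> (int \<times> int) set" where
  "lattice_points Q = {vertex Q i |i. i \<le> length (steps Q)}"

definition paths_between :: "int \<times> int \<Rightarrow> int \<times> int \<Rightarrow> 'l lattice_path set" where
  "paths_between p q = {Q. start Q = p \<and> vertex Q (length (steps Q)) = q}"

definition paths :: "nat \<Rightarrow> nat \<Rightarrow> unit lattice_path set" where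
  "paths a b = paths_between (0, 0) (int a, int b)"

definition level :: "nat \<Rightarrow> nat \<Rightarrow> int \<times> int \<Rightarrow> int" where
  "level a b v = int a * snd v - int b * fst v"

definition dyck_paths :: "nat \<Rightarrow> nat \<Rightarrow> unit lattice_path set" where
  "dyck_paths a b = {Q \<in> paths a b.
     \<forall>i < length (steps Q). is_North (steps Q ! i) \<longrightarrow> level a b (vertex Q i) \<ge> 0}"

text \<open>
  \<open>Q\<^sub>v\<close> for a lattice point \<open>v = (x, y)\<close> on a path \<open>Q\<close> that starts at the origin; such a point
  is reached after exactly \<open>x + y\<close> steps.
\<close>

definition rotate_at :: "'l lattice_path \<Rightarrow> int \<times> int \<Rightarrow> 'l lattice_path" where
  "rotate_at Q v =
     (let i = nat (fst v + snd v) in Path (0, 0) (drop i (steps Q) @ take i (steps Q)))"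

text \<open>A north step is among the last \<open>k + 1\<close> ones iff at most \<open>k\<close> north steps come after it.\<close>

definition k_stable :: "nat \<Rightarrow> nat \<Rightarrow> nat \<Rightarrow> unit lattice_path \<Rightarrow> bool" where
  "k_stable a b k Q \<longleftrightarrow>
     (\<forall>i < length (steps Q).
        is_North (steps Q ! i) \<and> length (filter is_North (drop (Suc i) (steps Q))) \<le> k
        \<longrightarrow> level a b (vertex Q i) \<ge> 0)"

definition k_skeletal :: "nat \<Rightarrow> nat \<Rightarrow> nat \<Rightarrow> unit lattice_path \<Rightarrow> bool" where
  "k_skeletal a b k Q \<longleftrightarrow> k_stable a b k Q \<and>
     (\<forall>v \<in> lattice_points Q. level a b v > 0 \<longrightarrow> \<not> k_stable a b k (rotate_at Q v))"

definition shift_len :: "nat \<Rightarrow> nat \<Rightarrow> nat" where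
  "shift_len a b = 1 + a div b"

text \<open>
  \<open>hat\<close> moves the last \<open>e = shift_len a b\<close> steps to the front. It is applied only to
  \<open>0\<close>-stable paths, whose last \<open>e\<close> steps are all east steps.
\<close>

definition hat :: "nat \<Rightarrow> nat \<Rightarrow> 'l lattice_path \<Rightarrow> 'l lattice_path" where
  "hat a b Q =
     (let n = length (steps Q) - shift_len a b
      in Path (- int (shift_len a b), 0) (drop n (steps Q) @ take n (steps Q)))"

definition real_point :: "int \<times> int \<Rightarrow> real \<times> real" where
  "real_point v = (real_of_int (fst v), real_of_int (snd v))"

definition triangle :: "nat \<Rightarrow> nat \<Rightarrow> (real \<times> real) set" where
  "triangle a b =
     (let e = real (shift_len a b)
      in convex hull {(- e, 0), (real a - e, 0), (real a - e, real b)})"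

definition inverted_dyck_paths :: "nat \<Rightarrow> nat \<Rightarrow> unit lattice_path set" where
  "inverted_dyck_paths a b =
     {Q \<in> paths_between (- int (shift_len a b), 0) (int a - int (shift_len a b), int b).
        \<forall>i < length (steps Q).
          closed_segment (real_point (vertex Q i)) (real_point (vertex Q (Suc i)))
            \<subseteq> triangle a b}"

definition star :: "nat \<Rightarrow> nat \<Rightarrow> 'l lattice_path \<Rightarrow> 'l lattice_path" where
  "star a b Q = Path (- int (shift_len a b), 0) (rev (steps Q))"

definition labels :: "'l step list \<Rightarrow> 'l list" where
  "labels w = map label (filter is_North w)"

text \<open>
  The labels on the \<open>b\<close> north steps are \<open>1, \<dots>, b\<close>, each used once, and they increase within
  each run of north steps.
\<close>

definition well_labeled :: "nat \<Rightarrow> nat lattice_path \<Rightarrow> bool" where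
  "well_labeled b Q \<longleftrightarrow>
     distinct (labels (steps Q)) \<and> set (labels (steps Q)) = {1..b} \<and>
     (\<forall>i j. i < j \<and> j < length (steps Q) \<and> (\<forall>m \<in> {i..j}. is_North (steps Q ! m))
        \<longrightarrow> label (steps Q ! i) < label (steps Q ! j))"

definition labeled_paths :: "nat \<Rightarrow> nat \<Rightarrow> nat lattice_path set" where
  "labeled_paths a b = {Q. underlying Q \<in> paths a b \<and> well_labeled b Q}"

definition labeled_dyck_paths :: "nat \<Rightarrow> nat \<Rightarrow> nat lattice_path set" where
  "labeled_dyck_paths a b = {Q. underlying Q \<in> dyck_paths a b \<and> well_labeled b Q}"

definition labeled_inverted_dyck_paths :: "nat \<Rightarrow> nat \<Rightarrow> nat lattice_path set" where
  "labeled_inverted_dyck_paths a b =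
     {Q. underlying Q \<in> inverted_dyck_paths a b \<and> well_labeled b Q}"

function sort_runs :: "nat step list \<Rightarrow> nat step list" where
  "sort_runs [] = []"
| "sort_runs (East # w) = East # sort_runs w"
| "sort_runs (North l # w) =
     map North (sort (l # labels (takeWhile is_North w))) @ sort_runs (dropWhile is_North w)"
  by pat_completeness auto
termination
  by (relation "Wellfounded.measure length") (auto simp: le_imp_less_Suc length_dropWhile_le)

definition labeled_star :: "nat \<Rightarrow> nat \<Rightarrow> nat lattice_path \<Rightarrow> nat lattice_path" where
  "labeled_star a b Q = Path (start (star a b Q)) (sort_runs (steps (star a b Q)))"

end

theory Submission
  imports Defs
begin

text \<open>
  Part (a) holds because rotating at a point of positive level sends the origin to negative level.
  For (b), a rotation at a point \<open>v\<close> of positive level fails to be \<open>0\<close>-stable iff fewer than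
  \<open>e\<close> east steps immediately precede \<open>v\<close>. If some point of \<open>Q\<close> had level above \<open>b e\<close>, then a
  point of maximal level would be followed by at least \<open>e\<close> east steps (a north step after fewer of
  them would rise above the maximum), after which the level is still positive. Hence \<open>Q\<close> is
  \<open>0\<close>-skeletal iff its levels never exceed \<open>b e\<close>, which says that \<open>hat\<close> stays in the triangle.
  For the labeled version of (c), a well-labeled path is determined by the list of label sets of
  its runs; sorting preserves this list and reversal reverses it.
\<close>

section \<open>Heights of words\<close>

text \<open>The level of the end point of \<open>w\<close> read as a walk from the origin. It is
  additive under concatenation and blind to labels, so points of a path become factorizations
  \<open>w = u @ v\<close> and rotations become \<open>v @ u\<close>.\<close>

definition height :: "nat \<Rightarrow> nat \<Rightarrow> 'l step list \<Rightarrow> int" where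
  "height a b w =
     int a * int (length (filter is_North w)) - int b * int (length (filter is_East w))"

lemma height_Nil [simp]: "height a b [] = 0"
  by (simp add: height_def)

lemma height_North [simp]: "height a b (North l # w) = int a + height a b w"
  by (simp add: height_def algebra_simps)

lemma height_East [simp]: "height a b (East # w) = height a b w - int b"
  by (simp add: height_def algebra_simps)

lemma height_append [simp]: "height a b (u @ v) = height a b u + height a b v"
  by (simp add: height_def algebra_simps)

lemma height_rev [simp]: "height a b (rev w) = height a b w"
  by (simp add: height_def flip: rev_filter)

lemma height_replicate_East [simp]: "height a b (replicate n East) = - int b * int n"
  by (induction n) (auto simp: algebra_simps)

lemma is_North_map_step [simp]: "is_North (map_step f x) = is_North x"
  by (cases x) auto

lemma is_East_map_step [simp]: "is_East (map_step f x) = is_East x"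
  by (cases x) auto

lemma is_North_comp_map_step [simp]: "is_North \<circ> map_step f = is_North"
  by (rule ext) simp

lemma is_East_comp_map_step [simp]: "is_East \<circ> map_step f = is_East"
  by (rule ext) simp

lemma is_East_iff: "is_East x \<longleftrightarrow> \<not> is_North x"
  by (cases x) auto

lemma length_filter_map_step [simp]:
  "length (filter is_North (map (map_step f) w)) = length (filter is_North w)"
  "length (filter is_East (map (map_step f) w)) = length (filter is_East w)"
  by (simp_all add: filter_map)

lemma height_map_step [simp]: "height a b (map (map_step f) w) = height a b w"
  by (simp add: height_def filter_map)

lemma length_steps_split: "length (filter is_East w) + length (filter is_North w) = length w"
  using sum_length_filter_compl[of is_East w] by (simp add: is_East_iff cong: filter_cong)

lemma no_North_replicate: "filter is_North w = [] \<Longrightarrow> w = replicate (length w) East"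
  by (induction w) (auto split: if_splits simp: is_East_def[symmetric] is_East_iff[symmetric])

section \<open>Cutting words at the first or last north step\<close>

lemma is_North_E: "is_North x \<Longrightarrow> (\<And>l. x = North l \<Longrightarrow> P) \<Longrightarrow> P"
  by (cases x) auto

lemma split_first_North:
  "(\<exists>n. w = replicate n East) \<or> (\<exists>n l v. w = replicate n East @ North l # v)"
proof (induction w)
  case Nil
  then show ?case by simp
next
  case (Cons x w)
  show ?case
  proof (cases x)
    case East
    then show ?thesis using Cons by (metis replicate_Suc append_Cons)
  next
    case (North l)
    then show ?thesis by (metis replicate_0 append_Nil)
  qed
qed

lemma split_last_North:
  "(\<exists>n. w = replicate n East) \<or> (\<exists>n l u. w = u @ North l # replicate n East)"
  using split_first_North[of "rev w"]
  by (metis append.assoc append_Cons append_Nil rev.simps(2) rev_append rev_replicate rev_rev_ident)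

text \<open>The trailing block of east steps is the longest east prefix of the reversed word, so its
  length, and with it the cut, is determined by the word.\<close>

lemma split_last_North_unique:
  assumes "u @ North l # replicate n East = u' @ North l' # v" "filter is_North v = []"
  shows "u' = u"
proof -
  obtain m where v: "v = replicate m East" using no_North_replicate[OF assms(2)] by blast
  have "takeWhile is_East (rev (u @ North l # replicate n East)) = replicate n East"
    by (simp add: takeWhile_append)
  moreover have "takeWhile is_East (rev (u' @ North l' # v)) = replicate m East"
    by (simp add: takeWhile_append v)
  ultimately have "n = m" using assms(1) by (metis length_replicate)
  then show ?thesis using assms(1) v by simp
qed

section \<open>Paths as words\<close>

definition balanced :: "nat \<Rightarrow> nat \<Rightarrow> 'l step list \<Rightarrow> bool" where
  "balanced a b w \<longleftrightarrow> length (filter is_East w) = a \<and> length (filter is_North w) = b"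

text \<open>Constrains every prefix, not only those followed by a north step as in
  \<open>dyck_paths\<close>. For balanced words both conditions agree, and this form behaves well
  under reversal.\<close>

definition dyck_word :: "nat \<Rightarrow> nat \<Rightarrow> 'l step list \<Rightarrow> bool" where
  "dyck_word a b w \<longleftrightarrow> balanced a b w \<and> (\<forall>u v. w = u @ v \<longrightarrow> 0 \<le> height a b u)"

text \<open>The start of an inverted path is translated to the origin here, which puts the
  hypotenuse of the triangle on the line of level 0.\<close>

definition inverted_word :: "nat \<Rightarrow> nat \<Rightarrow> 'l step list \<Rightarrow> bool" where
  "inverted_word a b w \<longleftrightarrow> balanced a b w \<and> (\<forall>u v. w = u @ v \<longrightarrow> height a b u \<le> 0)"

definition stable_word :: "nat \<Rightarrow> nat \<Rightarrow> nat \<Rightarrow> 'l step list \<Rightarrow> bool" where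
  "stable_word a b k w \<longleftrightarrow>
     (\<forall>u l v. w = u @ North l # v \<and> length (filter is_North v) \<le> k \<longrightarrow> 0 \<le> height a b u)"

lemma height_balanced: "balanced a b w \<Longrightarrow> height a b w = 0"
  by (simp add: balanced_def height_def)

lemma balanced_rev [simp]: "balanced a b (rev w) = balanced a b w"
  by (simp add: balanced_def flip: rev_filter)

lemma balanced_rotate: "balanced a b (u @ v) = balanced a b (v @ u)"
  by (simp add: balanced_def add.commute)

lemma balanced_map_step [simp]: "balanced a b (map (map_step f) w) = balanced a b w"
  by (simp add: balanced_def filter_map)

lemma all_prefixes_iff: "(\<forall>u v. w = u @ v \<longrightarrow> P u) \<longleftrightarrow> (\<forall>i \<le> length w. P (take i w))"
proof safe
  fix i assume "\<forall>u v. w = u @ v \<longrightarrow> P u"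
  then show "P (take i w)" by (metis append_take_drop_id)
next
  fix u v assume "\<forall>i \<le> length (u @ v). P (take i (u @ v))" "w = u @ v"
  then show "P u" by (auto dest: spec[of _ "length u"])
qed

lemma dyck_word_map_step [simp]: "dyck_word a b (map (map_step f) w) = dyck_word a b w"
  unfolding dyck_word_def all_prefixes_iff by (simp add: take_map)

lemma inverted_word_map_step [simp]:
  "inverted_word a b (map (map_step f) w) = inverted_word a b w"
  unfolding inverted_word_def all_prefixes_iff by (simp add: take_map)

text \<open>Prefixes of \<open>rev w\<close> are reversed suffixes of \<open>w\<close>. The total
  height is 0, so a suffix has minus the height of the complementary prefix.\<close>

lemma inverted_word_rev: "inverted_word a b (rev w) \<longleftrightarrow> dyck_word a b w"
proof (cases "balanced a b w")
  case True
  have "(\<forall>u v. rev w = u @ v \<longrightarrow> height a b u \<le> 0) \<longleftrightarrow> (\<forall>u v. w = u @ v \<longrightarrow> 0 \<le> height a b u)"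
    (is "?L \<longleftrightarrow> ?R")
  proof
    assume L: ?L
    show ?R
    proof (intro allI impI)
      fix u v assume w: "w = u @ v"
      then have "height a b (rev v) \<le> 0" using L by (metis rev_append)
      then show "0 \<le> height a b u" using height_balanced[OF True] w by simp
    qed
  next
    assume R: ?R
    show ?L
    proof (intro allI impI)
      fix u v assume "rev w = u @ v"
      then have w: "w = rev v @ rev u" by (metis rev_append rev_rev_ident)
      then have "0 \<le> height a b (rev v)" using R by blast
      then show "height a b u \<le> 0" using height_balanced[OF True] w by simp
    qed
  qed
  then show ?thesis using True by (simp add: inverted_word_def dyck_word_def)
qed (simp add: inverted_word_def dyck_word_def)

lemma dyck_word_rev: "dyck_word a b (rev w) \<longleftrightarrow> inverted_word a b w"
  by (metis inverted_word_rev rev_rev_ident)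

section \<open>Translating the definitions on paths into conditions on words\<close>

lemma level_vertex: "level a b (vertex Q i) = level a b (start Q) + height a b (take i (steps Q))"
  by (simp add: level_def vertex_def height_def algebra_simps)

lemma paths_iff: "Q \<in> paths a b \<longleftrightarrow> start Q = (0, 0) \<and> balanced a b (steps Q)"
  by (auto simp: paths_def paths_between_def vertex_def balanced_def)

lemma level_0 [simp]: "level a b (0, 0) = 0"
  by (simp add: level_def)

lemma k_stable_iff:
  assumes "start Q = (0, 0)"
  shows "k_stable a b k Q \<longleftrightarrow> stable_word a b k (steps Q)"
proof
  assume S: "k_stable a b k Q"
  show "stable_word a b k (steps Q)"
    unfolding stable_word_def
  proof (intro allI impI, elim conjE)
    fix u l v
    assume w: "steps Q = u @ North l # v" and "length (filter is_North v) \<le> k"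
    then show "0 \<le> height a b u"
      using S assms unfolding k_stable_def
      by (auto simp: level_vertex dest!: spec[of _ "length u"])
  qed
next
  assume S: "stable_word a b k (steps Q)"
  show "k_stable a b k Q"
    unfolding k_stable_def
  proof (intro allI impI, elim conjE)
    fix i
    assume "i < length (steps Q)" "is_North (steps Q ! i)"
      "length (filter is_North (drop (Suc i) (steps Q))) \<le> k"
    then show "0 \<le> level a b (vertex Q i)"
      using S assms unfolding stable_word_def
      by (metis add_0 id_take_nth_drop is_North_E level_0 level_vertex)
  qed
qed

text \<open>
  A balanced word that is negative somewhere has a later north step, and the first such step
  starts at a negative height too.
\<close>

lemma dyck_word_iff_stable:
  assumes "balanced a b w" and "b \<le> Suc k"
  shows "dyck_word a b w \<longleftrightarrow> stable_word a b k w"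
proof
  assume "dyck_word a b w"
  then show "stable_word a b k w" by (auto simp: dyck_word_def stable_word_def)
next
  assume S: "stable_word a b k w"
  have "0 \<le> height a b u" if w: "w = u @ v" for u v
  proof (rule ccontr)
    assume neg: "\<not> 0 \<le> height a b u"
    have sum0: "height a b u + height a b v = 0" using height_balanced[OF assms(1)] w by simp
    from split_first_North[of v] show False
    proof (elim disjE exE)
      fix n assume "v = replicate n East"
      then have "height a b v \<le> 0" by simp
      then show False using neg sum0 by simp
    next
      fix n l v' assume v: "v = replicate n East @ North l # v'"
      \<comment> \<open>The north step just read is one of \<open>b\<close>, so at most
        \<open>b - 1\<close> and hence at most \<open>k\<close> come after it.\<close>
      have "length (filter is_North v') \<le> k"
        using assms w v by (auto simp: balanced_def)
      then have "0 \<le> height a b (u @ replicate n East)"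
        using S w v unfolding stable_word_def by (metis append.assoc)
      moreover have "0 \<le> int b * int n" by simp
      ultimately show False using neg by simp
    qed
  qed
  then show "dyck_word a b w" using assms by (auto simp: dyck_word_def)
qed

text \<open>Every north step has at most \<open>b - 1\<close> others after it, so the counting
  condition in \<open>k_stable\<close> excludes none.\<close>

lemma k_stable_large:
  assumes "balanced a b (steps Q)" "b \<le> Suc k"
  shows "k_stable a b k Q \<longleftrightarrow>
    (\<forall>i < length (steps Q). is_North (steps Q ! i) \<longrightarrow> level a b (vertex Q i) \<ge> 0)"
proof -
  have "length (filter is_North (drop (Suc i) (steps Q))) \<le> k"
    if "i < length (steps Q)" "is_North (steps Q ! i)" for i
  proof -
    have "length (filter is_North (steps Q)) \<ge> Suc (length (filter is_North (drop (Suc i) (steps Q))))"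
      using that by (subst id_take_nth_drop[OF that(1)]) simp
    then show ?thesis using assms by (simp add: balanced_def)
  qed
  then show ?thesis by (auto simp: k_stable_def)
qed

text \<open>With \<open>k = b\<close> all north steps are tested, so stability links the definition
  by north steps to the one by prefixes.\<close>

lemma dyck_paths_iff: "Q \<in> dyck_paths a b \<longleftrightarrow> start Q = (0, 0) \<and> dyck_word a b (steps Q)"
proof (cases "start Q = (0, 0) \<and> balanced a b (steps Q)")
  case True
  then show ?thesis
    using k_stable_large[of a b Q b] k_stable_iff[of Q a b b] dyck_word_iff_stable[of a b "steps Q" b]
    by (simp add: dyck_paths_def paths_iff)
qed (auto simp: dyck_paths_def paths_iff dyck_word_def)

lemma rotate_at_vertex:
  assumes "start Q = (0, 0)" "i \<le> length (steps Q)"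
  shows "rotate_at Q (vertex Q i) = Path (0, 0) (drop i (steps Q) @ take i (steps Q))"
proof -
  have "nat (fst (vertex Q i) + snd (vertex Q i)) = i"
    using assms length_steps_split[of "take i (steps Q)"] by (simp add: vertex_def)
  then show ?thesis by (simp add: rotate_at_def)
qed

text \<open>A lattice point of \<open>Q\<close> is the end of a prefix \<open>u\<close>, and
  rotating there swaps the two factors.\<close>

lemma k_skeletal_iff:
  assumes "start Q = (0, 0)"
  shows "k_skeletal a b k Q \<longleftrightarrow> stable_word a b k (steps Q) \<and>
    (\<forall>u v. steps Q = u @ v \<and> 0 < height a b u \<longrightarrow> \<not> stable_word a b k (v @ u))"
proof -
  have "(\<forall>v \<in> lattice_points Q. level a b v > 0 \<longrightarrow> \<not> k_stable a b k (rotate_at Q v)) \<longleftrightarrow>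
    (\<forall>i \<le> length (steps Q). 0 < height a b (take i (steps Q)) \<longrightarrow>
       \<not> stable_word a b k (drop i (steps Q) @ take i (steps Q)))"
  proof -
    have "lattice_points Q = vertex Q ` {..length (steps Q)}"
      by (auto simp: lattice_points_def)
    then show ?thesis using assms by (simp del: split_paired_All add: level_vertex rotate_at_vertex k_stable_iff) blast
  qed
  also have "\<dots> \<longleftrightarrow> (\<forall>u v. steps Q = u @ v \<and> 0 < height a b u \<longrightarrow> \<not> stable_word a b k (v @ u))"
  proof safe
    fix u v
    assume "\<forall>i \<le> length (steps Q). 0 < height a b (take i (steps Q)) \<longrightarrow>
       \<not> stable_word a b k (drop i (steps Q) @ take i (steps Q))"
      "steps Q = u @ v" "0 < height a b u" "stable_word a b k (v @ u)"
    then show False by (auto dest!: spec[of _ "length u"])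
  next
    fix i
    assume "\<forall>u v. steps Q = u @ v \<and> 0 < height a b u \<longrightarrow> \<not> stable_word a b k (v @ u)"
      "0 < height a b (take i (steps Q))" "stable_word a b k (drop i (steps Q) @ take i (steps Q))"
    then show False by (metis append_take_drop_id)
  qed
  finally show ?thesis using assms by (simp add: k_skeletal_def k_stable_iff)
qed

section \<open>The triangle\<close>

lemma triangle_eq:
  assumes "0 < a" "0 < b"
  shows "triangle a b = {(x, y). x \<le> real a - real (shift_len a b) \<and> 0 \<le> y \<and>
    real a * y \<le> real b * (x + real (shift_len a b))}"
proof -
  define e where "e = real (shift_len a b)"
  have "triangle a b = convex hull {(- e, 0), (real a - e, 0), (real a - e, real b)}"
    by (simp add: triangle_def e_def Let_def)
  also have "\<dots> = {(x, y). x \<le> real a - e \<and> 0 \<le> y \<and> real a * y \<le> real b * (x + e)}"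
  proof safe
    fix x y assume "(x, y) \<in> convex hull {(- e, 0), (real a - e, 0), (real a - e, real b)}"
    then obtain r s t where rst: "0 \<le> r" "0 \<le> s" "0 \<le> t" "r + s + t = 1"
      and xy: "x = r * (- e) + s * (real a - e) + t * (real a - e)" "y = t * real b"
      by (auto simp: convex_hull_3)
    have r: "r = 1 - s - t" using rst by simp
    have x: "x = (s + t) * real a - e" unfolding xy(1) r by (simp add: algebra_simps)
    have "(s + t) * real a \<le> 1 * real a" by (rule mult_right_mono) (use rst in auto)
    then show "x \<le> real a - e" using x by simp
    show "0 \<le> y" using xy rst by simp
    show "real a * y \<le> real b * (x + e)" using rst by (simp add: x xy(2) algebra_simps)
  next
    fix x y assume xy: "x \<le> real a - e" "0 \<le> y" "real a * y \<le> real b * (x + e)"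
    \<comment> \<open>Barycentric coordinates: \<open>y\<close> fixes the weight \<open>t\<close> of
      the top corner and \<open>x\<close> the weight \<open>r\<close> of the left one. The three
      inequalities say exactly that \<open>r\<close>, \<open>s\<close> and \<open>t\<close> are
      nonnegative.\<close>
    define t where "t = y / real b"
    define r where "r = 1 - (x + e) / real a"
    define s where "s = (x + e) / real a - y / real b"
    have "0 \<le> r" "0 \<le> s" "0 \<le> t" "r + s + t = 1"
      using xy assms by (auto simp: r_def s_def t_def field_simps)
    moreover have "x = r * (- e) + s * (real a - e) + t * (real a - e)" "y = t * real b"
      using assms by (auto simp: r_def s_def t_def field_simps)
    ultimately show "(x, y) \<in> convex hull {(- e, 0), (real a - e, 0), (real a - e, real b)}"
      unfolding convex_hull_3
      by (intro CollectI exI[of _ r] exI[of _ s] exI[of _ t]) auto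
  qed
  finally show ?thesis by (simp add: e_def)
qed

text \<open>By convexity it suffices to test the vertices. The horizontal and vertical sides of the
  triangle bound them automatically, so only the hypotenuse remains, and it gives the sign of the
  height.\<close>

lemma inverted_dyck_paths_iff:
  assumes "0 < a" "0 < b"
  shows "Q \<in> inverted_dyck_paths a b \<longleftrightarrow>
    start Q = (- int (shift_len a b), 0) \<and> inverted_word a b (steps Q)"
proof (cases "start Q = (- int (shift_len a b), 0) \<and> balanced a b (steps Q)")
  case True
  define n where "n = length (steps Q)"
  \<comment> \<open>A path without steps has a vertex but no segment; here the last vertex is the
    end of one.\<close>
  have "n > 0" using True assms length_steps_split[of "steps Q"] unfolding n_def balanced_def by linarith
  have vertex_in: "real_point (vertex Q i) \<in> triangle a b \<longleftrightarrow> height a b (take i (steps Q)) \<le> 0" for i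
  proof -
    define x where "x = length (filter is_East (take i (steps Q)))"
    define y where "y = length (filter is_North (take i (steps Q)))"
    have "x + length (filter is_East (drop i (steps Q))) = length (filter is_East (steps Q))"
      unfolding x_def by (metis append_take_drop_id filter_append length_append)
    then have x: "x \<le> a" using True by (simp add: balanced_def)
    have "height a b (take i (steps Q)) \<le> 0 \<longleftrightarrow> int a * int y \<le> int b * int x"
      by (simp add: height_def x_def y_def)
    also have "\<dots> \<longleftrightarrow> real a * real y \<le> real b * real x"
      by (simp flip: of_nat_mult)
    also have "\<dots> \<longleftrightarrow> real_point (vertex Q i) \<in> triangle a b"
      using True x
      by (auto simp: triangle_eq[OF assms] real_point_def vertex_def simp flip: x_def y_def)
    finally show ?thesis by simp
  qed
  have "(\<forall>i < n. closed_segment (real_point (vertex Q i)) (real_point (vertex Q (Suc i))) \<subseteq> triangle a b)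
    \<longleftrightarrow> (\<forall>i \<le> n. real_point (vertex Q i) \<in> triangle a b)" (is "?L \<longleftrightarrow> ?R")
  proof
    assume L: ?L
    show ?R
    proof (intro allI impI)
      fix i assume "i \<le> n"
      show "real_point (vertex Q i) \<in> triangle a b"
      proof (cases "i < n")
        case True
        then show ?thesis using L ends_in_segment by blast
      next
        case False
        then obtain j where "i = Suc j" "j < n" using \<open>n > 0\<close> \<open>i \<le> n\<close> by (cases i) auto
        then show ?thesis using L ends_in_segment by blast
      qed
    qed
  next
    assume R: ?R
    have "convex (triangle a b)" by (simp add: triangle_def Let_def)
    then show ?L using R by (simp add: closed_segment_subset)
  qed
  moreover have "vertex Q n = (int a - int (shift_len a b), int b)"
    using True by (simp add: vertex_def n_def balanced_def)
  ultimately show ?thesis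
    using True unfolding inverted_dyck_paths_def paths_between_def
    unfolding inverted_word_def all_prefixes_iff by (simp add: vertex_in flip: n_def)
next
  case False
  then show ?thesis
    by (auto simp: inverted_dyck_paths_def paths_between_def inverted_word_def vertex_def balanced_def)
qed

section \<open>Skeletal words\<close>

text \<open>For \<open>k = 0\<close> only the last north step is tested, and its position is
  unique.\<close>

lemma stable_word_0_iff:
  "stable_word a b 0 (u @ North l # replicate n East) \<longleftrightarrow> 0 \<le> height a b u"
proof
  assume "stable_word a b 0 (u @ North l # replicate n East)"
  then show "0 \<le> height a b u" by (auto simp: stable_word_def)
next
  assume "0 \<le> height a b u"
  then show "stable_word a b 0 (u @ North l # replicate n East)"
    unfolding stable_word_def using split_last_North_unique by fastforce
qed

lemma shift_len_gt: "0 < b \<Longrightarrow> a < b * shift_len a b"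
  by (simp add: shift_len_def) (metis dividend_less_times_div)

text \<open>Coprimality and \<open>1 < b\<close> rule out \<open>a = b * n\<close>, so
  \<open>shift_len a b\<close> is the least number of east steps that makes up for one north
  step.\<close>

lemma shift_len_le:
  assumes "1 < b" "coprime a b" "int a \<le> int b * int n"
  shows "shift_len a b \<le> n"
proof -
  have "a \<noteq> b * n"
    using assms by (metis coprime_common_divisor_nat dvd_refl dvd_triv_left less_numeral_extra(4))
  then have "a < n * b" using assms(3) by (metis mult.commute nat_less_le of_nat_le_iff of_nat_mult)
  then show ?thesis using less_mult_imp_div_less[of a n b] by (simp add: shift_len_def)
qed

text \<open>The last north step ends at height at least \<open>a\<close>, and the east steps after
  it must descend to 0. This is why \<open>hat\<close> moves only east steps.\<close>

lemma stable_word_tail: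
  assumes "balanced a b w" "stable_word a b 0 w" "1 < b" "coprime a b"
  obtains u where "w = u @ replicate (shift_len a b) East"
proof -
  from split_last_North[of w] obtain u l n where w: "w = u @ North l # replicate n East"
  proof (elim disjE exE)
    fix n assume "w = replicate n East"
    then show thesis using assms by (simp add: balanced_def)
  qed blast
  have "0 \<le> height a b u" using assms(2) unfolding w stable_word_0_iff .
  then have "int a \<le> int b * int n" using height_balanced[OF assms(1)] w by simp
  then have "shift_len a b \<le> n" by (rule shift_len_le[OF assms(3,4)])
  then have "replicate n East = replicate (n - shift_len a b) East @ replicate (shift_len a b) East"
    by (simp flip: replicate_add)
  then show thesis using that[of "u @ North l # replicate (n - shift_len a b) East"] w by simp
qed

text \<open>
  Rotating at a point of positive height that is preceded by exactly \<open>n\<close> east steps puts the last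
  north step at height \<open>b n - a\<close>, so the rotation is stable iff \<open>n\<close> is at least the shift length.
\<close>

lemma skeletal_0_iff:
  assumes "balanced a b w" "0 < a" "1 < b" "coprime a b"
  shows "(\<forall>u v. w = u @ v \<and> 0 < height a b u \<longrightarrow> \<not> stable_word a b 0 (v @ u)) \<longleftrightarrow>
    (\<forall>u v. w = u @ v \<longrightarrow> height a b u \<le> int b * int (shift_len a b))"
    (is "?L \<longleftrightarrow> ?R")
proof
  define e where "e = shift_len a b"
  have e: "int a < int b * int e"
    using shift_len_gt[of b a] assms by (metis e_def less_trans of_nat_less_iff of_nat_mult zero_less_one)
  have rotate: "stable_word a b 0 (v @ u @ North l # replicate n East) \<longleftrightarrow> e \<le> n"
    if w: "w = (u @ North l # replicate n East) @ v" for u v n and l :: 'a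
  proof -
    have "height a b (v @ u) = int b * int n - int a"
      using height_balanced[OF assms(1)] w by simp
    moreover have "int a \<le> int b * int n \<longleftrightarrow> e \<le> n"
    proof
      assume "int a \<le> int b * int n"
      then show "e \<le> n" using shift_len_le assms e_def by blast
    next
      assume "e \<le> n"
      then have "int b * int e \<le> int b * int n" by (intro mult_left_mono) auto
      then show "int a \<le> int b * int n" using e by linarith
    qed
    ultimately show ?thesis using stable_word_0_iff[of a b "v @ u" l n] by simp
  qed
  {
    assume R: ?R
    show ?L
    proof (intro allI impI, elim conjE)
      fix u v assume w: "w = u @ v" and pos: "0 < height a b u"
      from split_last_North[of u] show "\<not> stable_word a b 0 (v @ u)"
      proof (elim disjE exE)
        fix n assume "u = replicate n East"
        then show ?thesis using pos by (simp add: mult_less_0_iff)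
      next
        fix n l u' assume u: "u = u' @ North l # replicate n East"
        \<comment> \<open>The bound is used at the top of the last north step of \<open>u\<close>:
          \<open>n\<close> east steps from there still leave a positive height.\<close>
        have "height a b (u' @ [North l]) \<le> int b * int e"
          using R w u unfolding e_def by (metis append.assoc append_Cons append_Nil)
        then have "int b * int n < int b * int e" using pos u by simp
        then have "n < e" by (simp add: mult_less_cancel_left)
        then show ?thesis using rotate w u by simp
      qed
    qed
  }
  assume L: ?L
  show ?R
  proof (rule ccontr)
    assume "\<not> ?R"
    then obtain i where i: "i \<le> length w" "int b * int e < height a b (take i w)"
      unfolding all_prefixes_iff e_def by auto
    \<comment> \<open>The prefix \<open>u\<close> chosen below attains the maximal height
      \<open>m\<close>, which bounds how soon a north step can follow.\<close>
    define m where "m = Max ((\<lambda>i. height a b (take i w)) ` {..length w})"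
    have "m \<in> (\<lambda>i. height a b (take i w)) ` {..length w}"
      unfolding m_def by (intro Max_in) auto
    then obtain j where j: "j \<le> length w" "height a b (take j w) = m" by auto
    have le_m: "height a b (take k w) \<le> m" if "k \<le> length w" for k
      unfolding m_def using that by (intro Max_ge) auto
    have max: "height a b p \<le> m" if "w = p @ s" for p s
      using le_m[of "length p"] that by simp
    have m: "int b * int e < m" using le_m[OF i(1)] i(2) by simp
    define u where "u = take j w"
    define v where "v = drop j w"
    have w: "w = u @ v" and hu: "height a b u = m" using j by (auto simp: u_def v_def)
    have "\<exists>s. v = replicate e East @ s"
      using split_first_North[of v]
    proof (elim disjE exE)
      fix n assume v: "v = replicate n East"
      \<comment> \<open>Without further north steps, east steps alone must bring the height from
        \<open>m\<close> down to 0.\<close>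
      have "int b * int e < int b * int n" using m height_balanced[OF assms(1)] w hu v by simp
      then have "e \<le> n" by (simp add: mult_less_cancel_left)
      then show ?thesis using v by (metis le_add_diff_inverse replicate_add)
    next
      fix n l s assume v: "v = replicate n East @ North l # s"
      have "height a b (u @ replicate n East @ [North l]) \<le> m"
        by (rule max[of _ s]) (simp add: w v)
      then have "int a \<le> int b * int n" using hu by simp
      then have "e \<le> n" using shift_len_le assms e_def by blast
      then have "replicate n East = replicate e East @ replicate (n - e) East"
        by (simp flip: replicate_add)
      then have "v = replicate e East @ (replicate (n - e) East @ North l # s)" using v by simp
      then show ?thesis ..
    qed
    then obtain s where v: "v = replicate e East @ s" ..
    from split_last_North[of u] show False
    proof (elim disjE exE)
      fix n assume "u = replicate n East"
      then have "m \<le> 0" using hu by (simp flip: hu)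
      then show False using m e by linarith
    next
      fix n l p assume u: "u = p @ North l # replicate n East"
      \<comment> \<open>Cutting after \<open>e\<close> more east steps leaves height
        \<open>m - b e > 0\<close> and at least \<open>e\<close> east steps before the cut, so this
        rotation is stable.\<close>
      have w': "w = (p @ North l # replicate (n + e) East) @ s" using w u v by (simp add: replicate_add)
      moreover have "0 < height a b (p @ North l # replicate (n + e) East)"
        using m hu u by (simp add: algebra_simps)
      ultimately have "\<not> stable_word a b 0 (s @ p @ North l # replicate (n + e) East)"
        using L by simp
      then show False using rotate[OF w'] by simp
    qed
  qed
qed

text \<open>Moving the east block to the front lowers each prefix of \<open>u\<close> by
  \<open>b e\<close>. Prefixes ending inside the block cause no trouble: in front they have height
  at most 0, at the end at most the height of \<open>u\<close>.\<close>

lemma inverted_word_shift: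
  assumes "balanced a b (u @ replicate e East)"
  shows "inverted_word a b (replicate e East @ u) \<longleftrightarrow>
    (\<forall>p s. u @ replicate e East = p @ s \<longrightarrow> height a b p \<le> int b * int e)"
    (is "_ \<longleftrightarrow> ?R")
proof -
  have "(\<forall>p s. replicate e East @ u = p @ s \<longrightarrow> height a b p \<le> 0) \<longleftrightarrow> ?R" (is "?L \<longleftrightarrow> _")
  proof
    assume L: ?L
    show ?R
    proof (intro allI impI)
      fix p s assume *: "u @ replicate e East = p @ s"
      have prefix: "height a b q \<le> int b * int e" if "u = q @ r" for q r
        using L[rule_format, of "replicate e East @ q" r] that by simp
      from * show "height a b p \<le> int b * int e"
      proof (subst (asm) append_eq_append_conv2, elim exE disjE conjE)
        fix us assume "u = p @ us"
        then show ?thesis by (rule prefix)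
      next
        fix us assume us: "u @ us = p" "replicate e East = us @ s"
        then have "us = replicate (length us) East" by (metis append_eq_conv_conj take_replicate length_replicate)
        then have "height a b us \<le> 0"
          by (metis height_replicate_East mult_minus_left mult_nonneg_nonneg neg_le_0_iff_le of_nat_0_le_iff)
        then show ?thesis using us(1) prefix[of u "[]"] by auto
      qed
    qed
  next
    assume R: ?R
    show ?L
    proof (intro allI impI)
      fix p s assume *: "replicate e East @ u = p @ s"
      then show "height a b p \<le> 0"
      proof (subst (asm) append_eq_append_conv2, elim exE disjE conjE)
        fix us assume "replicate e East = p @ us"
        then have "p = replicate (length p) East" by (metis append_eq_conv_conj take_replicate length_replicate)
        then show ?thesis
          by (metis height_replicate_East mult_minus_left mult_nonneg_nonneg neg_le_0_iff_le of_nat_0_le_iff)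
      next
        fix us assume us: "replicate e East @ us = p" "u = us @ s"
        then have "height a b us \<le> int b * int e" using R by simp
        then show ?thesis using us(1) by auto
      qed
    qed
  qed
  then show ?thesis using assms balanced_rotate by (auto simp: inverted_word_def)
qed

section \<open>The statements for unlabeled paths\<close>

lemma steps_hat:
  assumes "steps Q = u @ replicate (shift_len a b) East"
  shows "hat a b Q = Path (- int (shift_len a b), 0) (replicate (shift_len a b) East @ u)"
  using assms by (simp add: hat_def Let_def)

text \<open>Stability for \<open>b - 1\<close> is the Dyck property, and it fails for
  \<open>v @ u\<close> because its prefix \<open>v\<close> has height
  \<open>- height a b u < 0\<close>.\<close>

lemma skeletal_last_iff_dyck:
  assumes "Q \<in> paths a b" "0 < b"
  shows "k_skeletal a b (b - 1) Q \<longleftrightarrow> Q \<in> dyck_paths a b"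
proof -
  have Q: "start Q = (0, 0)" "balanced a b (steps Q)" using assms by (auto simp: paths_iff)
  have "\<not> stable_word a b (b - 1) (v @ u)" if "steps Q = u @ v" "0 < height a b u" for u v
  proof
    assume "stable_word a b (b - 1) (v @ u)"
    moreover have "balanced a b (v @ u)" using Q(2) that(1) balanced_rotate by auto
    ultimately have "dyck_word a b (v @ u)" using dyck_word_iff_stable by force
    then have "0 \<le> height a b v" by (auto simp: dyck_word_def)
    then show False using height_balanced[OF Q(2)] that by simp
  qed
  then show ?thesis
    using Q dyck_word_iff_stable[of a b "steps Q" "b - 1"] by (auto simp: k_skeletal_iff dyck_paths_iff)
qed

lemma skeletal_0_iff_inverted:
  assumes "Q \<in> paths a b" "k_stable a b 0 Q" "0 < a" "1 < b" "coprime a b"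
  shows "k_skeletal a b 0 Q \<longleftrightarrow> hat a b Q \<in> inverted_dyck_paths a b"
proof -
  have Q: "start Q = (0, 0)" "balanced a b (steps Q)" using assms by (auto simp: paths_iff)
  have st: "stable_word a b 0 (steps Q)" using assms(2) Q k_stable_iff by blast
  obtain u where u: "steps Q = u @ replicate (shift_len a b) East"
    using stable_word_tail[OF Q(2) st assms(4,5)] .
  have "k_skeletal a b 0 Q \<longleftrightarrow>
      (\<forall>u v. steps Q = u @ v \<longrightarrow> height a b u \<le> int b * int (shift_len a b))"
    using k_skeletal_iff[OF Q(1)] st skeletal_0_iff[OF Q(2) assms(3-5)] by simp
  also have "\<dots> \<longleftrightarrow> inverted_word a b (replicate (shift_len a b) East @ u)"
    using inverted_word_shift Q(2) u by metis
  also have "\<dots> \<longleftrightarrow> hat a b Q \<in> inverted_dyck_paths a b"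
    using assms by (simp add: steps_hat[OF u] inverted_dyck_paths_iff)
  finally show ?thesis .
qed

lemma bij_betw_star:
  assumes "0 < a" "0 < b"
  shows "bij_betw (star a b) (dyck_paths a b) (inverted_dyck_paths a b)"
proof (rule bij_betw_byWitness[where f' = "\<lambda>Q. Path (0, 0) (rev (steps Q))"])
  show "\<forall>Q \<in> dyck_paths a b. Path (0, 0) (rev (steps (star a b Q))) = Q"
    by (auto simp: dyck_paths_iff star_def intro: lattice_path.expand)
  show "\<forall>Q \<in> inverted_dyck_paths a b. star a b (Path (0, 0) (rev (steps Q))) = Q"
    using assms by (auto simp: inverted_dyck_paths_iff star_def intro: lattice_path.expand)
  show "star a b ` dyck_paths a b \<subseteq> inverted_dyck_paths a b"
    using assms by (auto simp: inverted_dyck_paths_iff dyck_paths_iff star_def inverted_word_rev)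
  show "(\<lambda>Q. Path (0, 0) (rev (steps Q))) ` inverted_dyck_paths a b \<subseteq> dyck_paths a b"
    using assms by (auto simp: inverted_dyck_paths_iff dyck_paths_iff dyck_word_rev)
qed

section \<open>Labels\<close>

text \<open>A condition on neighbours only, met by any pair containing an east step, so that
  increase within runs becomes a \<open>successively\<close> statement.\<close>

definition ordered_steps :: "nat step \<Rightarrow> nat step \<Rightarrow> bool" where
  "ordered_steps x y \<longleftrightarrow> (is_North x \<and> is_North y \<longrightarrow> label x < label y)"

lemma ordered_steps_simps [simp]:
  "ordered_steps East y" "ordered_steps x East" "ordered_steps (North k) (North l) \<longleftrightarrow> k < l"
  by (auto simp: ordered_steps_def)

text \<open>Within a run, comparisons of neighbours chain by transitivity.\<close>

lemma increasing_runs_iff: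
  "(\<forall>i j. i < j \<and> j < length w \<and> (\<forall>m \<in> {i..j}. is_North (w ! m)) \<longrightarrow> label (w ! i) < label (w ! j))
   \<longleftrightarrow> successively ordered_steps w" (is "?L \<longleftrightarrow> ?R")
proof
  assume L: ?L
  show ?R
    unfolding successively_conv_nth ordered_steps_def
  proof (intro allI impI, elim conjE)
    fix i assume "Suc i < length w" "is_North (w ! i)" "is_North (w ! Suc i)"
    moreover have "{i..Suc i} = {i, Suc i}" by auto
    ultimately show "label (w ! i) < label (w ! Suc i)" using L by simp
  qed
next
  assume R: ?R
  have "label (w ! i) < label (w ! j)"
    if "i < j" "j < length w" "\<forall>m \<in> {i..j}. is_North (w ! m)" for i j
    using that
  proof (induction j)
    case (Suc j)
    have "label (w ! j) < label (w ! Suc j)"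
      using R Suc.prems by (auto simp: successively_conv_nth ordered_steps_def)
    then show ?case using Suc by (cases "i = j") auto
  qed simp
  then show ?L by blast
qed

lemma well_labeled_iff:
  "well_labeled b Q \<longleftrightarrow> distinct (labels (steps Q)) \<and> set (labels (steps Q)) = {1..b} \<and>
    successively ordered_steps (steps Q)"
  unfolding well_labeled_def increasing_runs_iff ..

lemma labels_simps [simp]:
  "labels [] = []" "labels (East # w) = labels w" "labels (North l # w) = l # labels w"
  "labels (u @ v) = labels u @ labels v" "labels (rev w) = rev (labels w)"
  by (auto simp: labels_def rev_map rev_filter)

lemma labels_replicate_East [simp]: "labels (replicate n East) = []"
  by (induction n) auto

lemma labels_map_North [simp]: "labels (map North ls) = ls"
  by (induction ls) auto

lemma successively_replicate_East: "successively ordered_steps (replicate n East)"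
  by (simp add: successively_conv_nth)

text \<open>East steps carry no label and may stand next to anything.\<close>

lemma well_labeled_shift:
  "well_labeled b (Path p (u @ replicate n East)) \<longleftrightarrow> well_labeled b (Path q (replicate n East @ u))"
  by (cases "n = 0") (auto simp: well_labeled_iff successively_append_iff successively_replicate_East)

section \<open>Recovering a labeled word from the label multisets of its runs\<close>

text \<open>The multisets of labels on the maximal (possibly empty) runs between east steps.\<close>

fun runs :: "'l step list \<Rightarrow> 'l multiset list" where
  "runs [] = [{#}]"
| "runs (East # w) = {#} # runs w"
| "runs (North l # w) = add_mset l (hd (runs w)) # tl (runs w)"

lemma runs_not_Nil [simp]: "runs w \<noteq> []"
  by (induction w rule: runs.induct) auto

text \<open>This and the next lemma mirror the recursion of \<open>runs\<close> at the right end, as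
  needed for reversal.\<close>

lemma runs_append_East [simp]: "runs (w @ [East]) = runs w @ [{#}]"
  by (induction w rule: runs.induct) auto

lemma runs_append_North [simp]:
  "runs (w @ [North l]) = butlast (runs w) @ [add_mset l (last (runs w))]"
proof (induction w rule: runs.induct)
  case (3 k w)
  then show ?case by (cases "runs w") auto
qed auto

lemma runs_rev: "runs (rev w) = rev (runs w)"
proof (induction w rule: runs.induct)
  case (3 l w)
  then show ?case by (cases "runs w") auto
qed auto

lemma runs_map_North_append:
  "runs (map North ls @ w) = (mset ls + hd (runs w)) # tl (runs w)"
  by (induction ls) auto

lemma sum_list_runs: "sum_list (runs w) = mset (labels w)"
proof (induction w rule: runs.induct)
  case (3 l w)
  then show ?case by (cases "runs w") auto
qed auto

lemma takeWhile_is_North: "takeWhile is_North w = map North (labels (takeWhile is_North w))"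
  by (induction w) (auto elim: is_North_E)

text \<open>Sorting permutes labels inside one run, and multisets forget the order.\<close>

lemma runs_sort_runs: "runs (sort_runs w) = runs w"
proof (induction w rule: sort_runs.induct)
  case (3 l w)
  have "runs w = runs (map North (labels (takeWhile is_North w)) @ dropWhile is_North w)"
    by (metis takeWhile_is_North takeWhile_dropWhile_id)
  then show ?case using 3 by (simp only: runs.simps sort_runs.simps runs_map_North_append) simp
qed auto

text \<open>Without labels a run is known by its length, which sorting keeps. Hence the Dyck and
  inverted properties survive \<open>sort_runs\<close>.\<close>

lemma unlabeled_sort_runs: "map (map_step (\<lambda>_. ())) (sort_runs w) = map (map_step (\<lambda>_. ())) w"
proof (induction w rule: sort_runs.induct)
  case (3 l w)
  have unl: "map (map_step (\<lambda>_. ())) (map North ls) = replicate (length ls) (North ())" for ls :: "nat list"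
    by (induction ls) auto
  have "map (map_step (\<lambda>_. ())) (North l # w) =
    map (map_step (\<lambda>_. ())) (map North (l # labels (takeWhile is_North w)) @ dropWhile is_North w)"
    by (metis takeWhile_is_North takeWhile_dropWhile_id append_Cons list.simps(9))
  then show ?case using 3 by (simp only: sort_runs.simps map_append unl length_sort)
qed auto

lemma mset_labels_sort_runs: "mset (labels (sort_runs w)) = mset (labels w)"
  by (metis runs_sort_runs sum_list_runs)

lemma successively_sort_runs:
  "distinct (labels w) \<Longrightarrow> successively ordered_steps (sort_runs w)"
proof (induction w rule: sort_runs.induct)
  case (2 w)
  then show ?case by (cases "sort_runs w") auto
next
  case (3 l w)
  let ?L = "l # labels (takeWhile is_North w)"
  have w: "labels w = labels (takeWhile is_North w) @ labels (dropWhile is_North w)"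
    by (metis labels_simps(4) takeWhile_dropWhile_id)
  have "sorted_wrt (<) (sort ?L)"
    using 3 w by (simp only: strict_sorted_iff distinct_sort sorted_sort) simp
  then have "successively (<) (sort ?L)"
    by (rule successively_if_sorted_wrt)
  then have "successively ordered_steps (map North (sort ?L))"
    by (simp only: successively_map ordered_steps_simps)
  moreover have "successively ordered_steps (sort_runs (dropWhile is_North w))" using 3 w by simp
  \<comment> \<open>Nothing is compared across the seam: what follows the sorted run is empty or
    begins with an east step.\<close>
  moreover have "sort_runs (dropWhile is_North w) = [] \<or> hd (sort_runs (dropWhile is_North w)) = East"
  proof (cases "dropWhile is_North w")
    case (Cons x v)
    then have "x = East" by (metis hd_dropWhile is_East_def is_East_iff list.discI list.sel(1))
    then show ?thesis using Cons by simp
  qed (simp only: sort_runs.simps simp_thms)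
  ultimately show ?case by (auto simp only: sort_runs.simps successively_append_iff ordered_steps_simps)
qed auto

text \<open>Makes the first label of a run recoverable from its multiset, as the least
  element.\<close>

lemma first_label_less:
  "successively ordered_steps (North l # w) \<Longrightarrow> k \<in># hd (runs w) \<Longrightarrow> l < k"
proof (induction w arbitrary: l rule: runs.induct)
  case (3 m w)
  then have "l < m" "k = m \<or> k \<in># hd (runs w)" "successively ordered_steps (North m # w)" by auto
  then show ?case using 3(1) by (auto intro: less_trans)
qed auto

text \<open>The word is rebuilt from the left: an empty first multiset means an east step or the
  end, a nonempty one a north step with its least label.\<close>

lemma runs_inject:
  "successively ordered_steps w \<Longrightarrow> successively ordered_steps w' \<Longrightarrow> runs w = runs w' \<Longrightarrow> w = w'"
proof (induction w arbitrary: w' rule: runs.induct)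
  case 1
  \<comment> \<open>An east step in \<open>w'\<close> would create a second entry, and a leading
    north step a nonempty first one.\<close>
  then have "length (runs w') = 1" by (metis length_Cons list.size(3) One_nat_def runs.simps(1))
  then show ?case using 1 by (cases w' rule: runs.cases) auto
next
  case (2 w)
  from "2.prems"(3) obtain v where w': "w' = East # v" by (cases w' rule: runs.cases) auto
  then have "successively ordered_steps w" "successively ordered_steps v" "runs w = runs v"
    using "2.prems" by (auto simp: successively_Cons)
  then show ?case using "2.IH" w' by blast
next
  case (3 l w)
  from "3.prems"(3) obtain l' v where w': "w' = North l' # v" by (cases w' rule: runs.cases) auto
  have eq: "add_mset l (hd (runs w)) = add_mset l' (hd (runs v))" "tl (runs w) = tl (runs v)"
    using "3.prems"(3) w' by auto
  have "l = l'"
  proof (rule ccontr)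
    assume "l \<noteq> l'"
    \<comment> \<open>Each of the two labels would occur later in the run begun by the other, giving
      both \<open>l < l'\<close> and \<open>l' < l\<close>.\<close>
    then have "l' \<in># hd (runs w)" "l \<in># hd (runs v)"
      using eq(1) by (metis insert_noteq_member)+
    then show False using first_label_less "3.prems"(1,2) w' by (metis less_asym)
  qed
  moreover have "runs w = runs v" using eq \<open>l = l'\<close> by (metis add_mset_add_mset_same_iff list.expand runs_not_Nil)
  moreover have "successively ordered_steps w" "successively ordered_steps v"
    using "3.prems"(1,2) w' by (auto simp: successively_Cons)
  ultimately show ?case using "3.IH" w' by blast
qed

text \<open>Both sides increase within runs and have equal \<open>runs\<close>: sorting leaves these
  unchanged and the two reversals cancel.\<close>

lemma sort_runs_rev_involution:
  assumes "successively ordered_steps w" "distinct (labels w)"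
  shows "sort_runs (rev (sort_runs (rev w))) = w"
proof (rule runs_inject)
  have "distinct (labels (sort_runs (rev w)))"
    using assms(2) mset_labels_sort_runs[of "rev w"] by (metis distinct_rev labels_simps(5) mset_eq_imp_distinct_iff)
  then show "successively ordered_steps (sort_runs (rev (sort_runs (rev w))))"
    by (intro successively_sort_runs) simp
qed (use assms in \<open>auto simp: runs_sort_runs runs_rev\<close>)

lemma well_labeled_sort_runs_rev:
  assumes "well_labeled b Q"
  shows "well_labeled b (Path p (sort_runs (rev (steps Q))))"
proof -
  have m: "mset (labels (sort_runs (rev (steps Q)))) = mset (labels (steps Q))"
    by (simp add: mset_labels_sort_runs)
  then show ?thesis
    using assms successively_sort_runs[of "rev (steps Q)"] mset_eq_imp_distinct_iff[OF m] mset_eq_setD[OF m]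
    by (simp add: well_labeled_iff)
qed

section \<open>The statements for labeled paths and the theorem\<close>

lemma underlying_sel [simp]:
  "start (underlying Q) = start Q"
  "steps (underlying Q) = map (map_step (\<lambda>_. ())) (steps Q)"
  by (cases Q; simp add: underlying_def)+

lemma labeled_dyck_paths_iff:
  "Q \<in> labeled_dyck_paths a b \<longleftrightarrow> start Q = (0, 0) \<and> dyck_word a b (steps Q) \<and> well_labeled b Q"
  by (auto simp: labeled_dyck_paths_def dyck_paths_iff)

lemma labeled_inverted_dyck_paths_iff:
  assumes "0 < a" "0 < b"
  shows "Q \<in> labeled_inverted_dyck_paths a b \<longleftrightarrow>
    start Q = (- int (shift_len a b), 0) \<and> inverted_word a b (steps Q) \<and> well_labeled b Q"
  using assms by (auto simp: labeled_inverted_dyck_paths_def inverted_dyck_paths_iff)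

lemma inverted_word_sort_runs [simp]: "inverted_word a b (sort_runs w) = inverted_word a b w"
  by (metis inverted_word_map_step unlabeled_sort_runs)

lemma dyck_word_sort_runs [simp]: "dyck_word a b (sort_runs w) = dyck_word a b w"
  by (metis dyck_word_map_step unlabeled_sort_runs)

lemma bij_betw_labeled_star:
  assumes "0 < a" "0 < b"
  shows "bij_betw (labeled_star a b) (labeled_dyck_paths a b) (labeled_inverted_dyck_paths a b)"
\<comment> \<open>The inverse is the same reversal and sorting, with the start put back at the
  origin.\<close>
proof (rule bij_betw_byWitness[where f' = "\<lambda>Q. Path (0, 0) (sort_runs (rev (steps Q)))"])
  show "\<forall>Q \<in> labeled_dyck_paths a b. Path (0, 0) (sort_runs (rev (steps (labeled_star a b Q)))) = Q"
    by (auto simp: labeled_dyck_paths_iff labeled_star_def star_def well_labeled_iff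
        sort_runs_rev_involution intro: lattice_path.expand)
  show "\<forall>Q \<in> labeled_inverted_dyck_paths a b.
      labeled_star a b (Path (0, 0) (sort_runs (rev (steps Q)))) = Q"
    using assms by (auto simp: labeled_inverted_dyck_paths_iff labeled_star_def star_def well_labeled_iff
        sort_runs_rev_involution intro: lattice_path.expand)
  show "labeled_star a b ` labeled_dyck_paths a b \<subseteq> labeled_inverted_dyck_paths a b"
    using assms by (auto simp: labeled_inverted_dyck_paths_iff labeled_dyck_paths_iff labeled_star_def
        star_def inverted_word_rev well_labeled_sort_runs_rev)
  show "(\<lambda>Q. Path (0, 0) (sort_runs (rev (steps Q)))) ` labeled_inverted_dyck_paths a b
      \<subseteq> labeled_dyck_paths a b"
    using assms by (auto simp: labeled_inverted_dyck_paths_iff labeled_dyck_paths_iff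
        well_labeled_sort_runs_rev dyck_word_rev)
qed

lemma underlying_hat: "underlying (hat a b Q) = hat a b (underlying Q)"
  by (rule lattice_path.expand) (simp add: hat_def Let_def take_map drop_map)

lemma well_labeled_hat:
  assumes "Q \<in> labeled_paths a b" "k_stable a b 0 (underlying Q)" "1 < b" "coprime a b"
  shows "well_labeled b (hat a b Q)"
proof -
  have Q: "start Q = (0, 0)" "balanced a b (steps Q)" "well_labeled b Q"
    using assms by (auto simp: labeled_paths_def paths_iff)
  have "stable_word a b 0 (steps (underlying Q))" using assms(2) Q k_stable_iff by force
  \<comment> \<open>The east tail is found in the underlying word and pulled back: forgetting labels
    keeps the kind of each step, so the tail of \<open>steps Q\<close> has no north step
    either.\<close>
  then obtain u where u: "map (map_step (\<lambda>_. ())) (steps Q) = u @ replicate (shift_len a b) East"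
    using stable_word_tail[of a b "steps (underlying Q)"] Q(2) assms(3,4) by auto
  then obtain v z where vz: "steps Q = v @ z" "map (map_step (\<lambda>_. ())) z = replicate (shift_len a b) East"
    by (auto simp: map_eq_append_conv)
  have "length (filter is_North (map (map_step (\<lambda>_. ())) z)) = 0"
    unfolding vz(2) by simp
  then have "filter is_North z = []" by (simp only: length_filter_map_step length_0_conv)
  moreover have "length z = shift_len a b" using vz(2) by (metis length_map length_replicate)
  ultimately have v: "steps Q = v @ replicate (shift_len a b) East"
    using no_North_replicate vz(1) by metis
  then show ?thesis
    using Q(3) well_labeled_shift steps_hat[OF v] by (metis lattice_path.collapse)
qed

theorem theorem4p9:
  fixes a b :: nat
  assumes "0 < a" and "1 < b" and "coprime a b"
  shows
    "(\<forall>Q \<in> paths a b. k_stable a b 0 Q \<longrightarrow>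
        (k_skeletal a b (b - 1) Q \<longleftrightarrow> Q \<in> dyck_paths a b)) \<and>
     (\<forall>Q \<in> paths a b. k_stable a b 0 Q \<longrightarrow>
        (k_skeletal a b 0 Q \<longleftrightarrow> hat a b Q \<in> inverted_dyck_paths a b)) \<and>
     bij_betw (star a b) (dyck_paths a b) (inverted_dyck_paths a b) \<and>
     (\<forall>Q \<in> labeled_paths a b. k_stable a b 0 (underlying Q) \<longrightarrow>
        (k_skeletal a b (b - 1) (underlying Q) \<longleftrightarrow> Q \<in> labeled_dyck_paths a b)) \<and>
     (\<forall>Q \<in> labeled_paths a b. k_stable a b 0 (underlying Q) \<longrightarrow>
        (k_skeletal a b 0 (underlying Q) \<longleftrightarrow> hat a b Q \<in> labeled_inverted_dyck_paths a b)) \<and>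
     bij_betw (labeled_star a b) (labeled_dyck_paths a b) (labeled_inverted_dyck_paths a b)"
proof (intro conjI ballI impI)
  have "0 < b" using assms by simp
  show "bij_betw (star a b) (dyck_paths a b) (inverted_dyck_paths a b)"
    "bij_betw (labeled_star a b) (labeled_dyck_paths a b) (labeled_inverted_dyck_paths a b)"
    using assms bij_betw_star bij_betw_labeled_star by auto
  show "k_skeletal a b (b - 1) Q \<longleftrightarrow> Q \<in> dyck_paths a b" if "Q \<in> paths a b" for Q
    using skeletal_last_iff_dyck[OF that \<open>0 < b\<close>] .
  show "k_skeletal a b 0 Q \<longleftrightarrow> hat a b Q \<in> inverted_dyck_paths a b"
    if "Q \<in> paths a b" "k_stable a b 0 Q" for Q
    using skeletal_0_iff_inverted[OF that assms] .
  fix Q assume Q: "Q \<in> labeled_paths a b" "k_stable a b 0 (underlying Q)"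
  then have P: "underlying Q \<in> paths a b" "well_labeled b Q" by (auto simp: labeled_paths_def)
  show "k_skeletal a b (b - 1) (underlying Q) \<longleftrightarrow> Q \<in> labeled_dyck_paths a b"
    using skeletal_last_iff_dyck[OF P(1) \<open>0 < b\<close>] P(2) by (simp add: labeled_dyck_paths_def)
  show "k_skeletal a b 0 (underlying Q) \<longleftrightarrow> hat a b Q \<in> labeled_inverted_dyck_paths a b"
    using skeletal_0_iff_inverted[OF P(1) Q(2) assms] well_labeled_hat[OF Q assms(2,3)]
    by (simp add: labeled_inverted_dyck_paths_def underlying_hat)
qed

end
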